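(* Let $X$ and $Y$ be nontrivial complex Banach spaces. Then $C_b(B_X,Y)$, $A_b(B_X,Y)$ and $A_u(B_X,Y)$ have the diameter two property (D2P).
   Context: $B_X$ is the closed unit ball of $X$ with the norm topology. $C_b(B_X,Y)$ is the Banach space of bounded continuous functions $B_X\to Y$ with the supremum norm. $A_b(B_X,Y)$ is the closed subspace of $C_b(B_X,Y)$ consisting of those functions that are holomorphic on the interior of $B_X$. $A_u(B_X,Y)$ is the closed subspace of $A_b(B_X,Y)$ consisting of those functions that are uniformly continuous on $B_X$. A Banach space has the diameter two property (D2P) if every nonempty relatively weakly open subset of its closed unit ball has diameter two. *)

theory Defs
  imports "HOL-Analysis.Analysis"
begin

section \<open>Complex Banach spaces\<close>

class complex_normed_vector = real_normed_vector +
  fixes scaleC :: "complex \<Rightarrow> 'a \<Rightarrow> 'a"  (infixr \<open>*\<^sub>C\<close> 75)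
  assumes scaleC_add_right: "c *\<^sub>C (x + y) = c *\<^sub>C x + c *\<^sub>C y"
    and scaleC_add_left: "(c + d) *\<^sub>C x = c *\<^sub>C x + d *\<^sub>C x"
    and scaleC_scaleC: "c *\<^sub>C (d *\<^sub>C x) = (c * d) *\<^sub>C x"
    and scaleC_of_real: "complex_of_real r *\<^sub>C x = r *\<^sub>R x"
    and norm_scaleC: "norm (c *\<^sub>C x) = cmod c * norm x"

class complex_banach = complex_normed_vector + banach

instantiation complex :: complex_banach
begin

definition scaleC_complex :: "complex \<Rightarrow> complex \<Rightarrow> complex"
  where "scaleC_complex c z = c * z"

instance
  by standard (auto simp: scaleC_complex_def algebra_simps norm_mult scaleR_conv_of_real)

end

lemma bounded_linear_scaleC:
  "bounded_linear (\<lambda>x::'a::complex_normed_vector. c *\<^sub>C x)"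
proof (rule bounded_linear_intro)
  fix x y :: 'a and r :: real
  show "c *\<^sub>C (x + y) = c *\<^sub>C x + c *\<^sub>C y"
    by (rule scaleC_add_right)
  show "c *\<^sub>C (r *\<^sub>R x) = r *\<^sub>R (c *\<^sub>C x)"
    by (simp add: scaleC_scaleC mult.commute flip: scaleC_of_real)
  show "norm (c *\<^sub>C x) \<le> norm x * cmod c"
    by (simp add: norm_scaleC mult.commute)
qed

definition csubspace :: "'a::complex_normed_vector set \<Rightarrow> bool"
  where "csubspace V \<longleftrightarrow>
    0 \<in> V \<and> (\<forall>x\<in>V. \<forall>y\<in>V. x + y \<in> V) \<and> (\<forall>c. \<forall>x\<in>V. c *\<^sub>C x \<in> V)"


section \<open>Weak topology and the diameter two property\<close>

text \<open>
  A Banach space is represented by a linear subspace \<open>V\<close> of an ambient normed space. Its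
  functionals are bounded and complex-linear on \<open>V\<close> only; their values outside \<open>V\<close> are arbitrary
  and play no role in the weak topology of \<open>V\<close>.
\<close>

definition cdual :: "'a::complex_normed_vector set \<Rightarrow> ('a \<Rightarrow> complex) set"
  where "cdual V = {\<phi>.
    (\<forall>x\<in>V. \<forall>y\<in>V. \<phi> (x + y) = \<phi> x + \<phi> y) \<and>
    (\<forall>c. \<forall>x\<in>V. \<phi> (c *\<^sub>C x) = c * \<phi> x) \<and>
    (\<exists>K. \<forall>x\<in>V. cmod (\<phi> x) \<le> K * norm x)}"

definition weak_topology :: "'a::complex_normed_vector set \<Rightarrow> 'a topology"
  where "weak_topology V =
    topology_generated_by {{x \<in> V. \<phi> x \<in> U} | \<phi> U. \<phi> \<in> cdual V \<and> open U}"

lemma topspace_weak_topology: "topspace (weak_topology V) = V"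
proof -
  have "(\<lambda>_. 0) \<in> cdual V"
    by (auto simp: cdual_def intro!: exI[of _ 0])
  then have "V \<in> {{x \<in> V. \<phi> x \<in> U} | \<phi> U. \<phi> \<in> cdual V \<and> open U}"
    by (auto intro!: exI[of _ "\<lambda>_. 0"] exI[of _ UNIV])
  then show ?thesis
    unfolding weak_topology_def topology_generated_by_topspace by auto
qed

definition diameter_two_property :: "'a::complex_normed_vector set \<Rightarrow> bool"
  where "diameter_two_property V \<longleftrightarrow>
    (\<forall>W. openin (subtopology (weak_topology V) (V \<inter> cball 0 1)) W \<and> W \<noteq> {}
      \<longrightarrow> diameter W = 2)"


section \<open>The closed unit ball as a metric space\<close>

typedef (overloaded) 'a unit_ball = "cball (0 :: 'a::real_normed_vector) 1"
  by (rule exI[of _ 0]) simp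

instantiation unit_ball :: (real_normed_vector) metric_space
begin

definition dist_unit_ball :: "'a unit_ball \<Rightarrow> 'a unit_ball \<Rightarrow> real"
  where "dist_unit_ball x y = dist (Rep_unit_ball x) (Rep_unit_ball y)"

definition uniformity_unit_ball :: "('a unit_ball \<times> 'a unit_ball) filter"
  where "uniformity_unit_ball = (INF e\<in>{0<..}. principal {(x, y). dist x y < e})"

definition open_unit_ball :: "'a unit_ball set \<Rightarrow> bool"
  where "open_unit_ball U \<longleftrightarrow>
    (\<forall>x\<in>U. eventually (\<lambda>(x', y). x' = x \<longrightarrow> y \<in> U) uniformity)"

instance
  by standard
    (auto simp: dist_unit_ball_def Rep_unit_ball_inject uniformity_unit_ball_def
      open_unit_ball_def dist_triangle2)

end


section \<open>The function spaces\<close>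

instantiation bcontfun :: (topological_space, complex_normed_vector) complex_normed_vector
begin

definition scaleC_bcontfun :: "complex \<Rightarrow> ('a \<Rightarrow>\<^sub>C 'b) \<Rightarrow> ('a \<Rightarrow>\<^sub>C 'b)"
  where "scaleC_bcontfun c f = Bcontfun (\<lambda>x. c *\<^sub>C apply_bcontfun f x)"

lemma apply_bcontfun_scaleC:
  "apply_bcontfun (c *\<^sub>C f) x = c *\<^sub>C apply_bcontfun f x" for f :: "'a \<Rightarrow>\<^sub>C 'b"
proof -
  have "continuous_on UNIV (\<lambda>x. c *\<^sub>C apply_bcontfun f x)"
    by (intro bounded_linear.continuous_on[OF bounded_linear_scaleC]
        continuous_on_apply_bcontfun)
  moreover have "bounded (range (\<lambda>x. c *\<^sub>C apply_bcontfun f x))"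
    using bounded_linear_image[OF bounded_apply_bcontfun[of f] bounded_linear_scaleC[of c]]
    by (simp add: image_image)
  ultimately show ?thesis
    by (simp add: scaleC_bcontfun_def Bcontfun_inverse bcontfun_def)
qed

instance
proof
  fix c d :: complex and r :: real and f g :: "'a \<Rightarrow>\<^sub>C 'b"
  show "c *\<^sub>C (f + g) = c *\<^sub>C f + c *\<^sub>C g"
    by (rule bcontfun_eqI) (simp add: apply_bcontfun_scaleC scaleC_add_right)
  show "(c + d) *\<^sub>C f = c *\<^sub>C f + d *\<^sub>C f"
    by (rule bcontfun_eqI) (simp add: apply_bcontfun_scaleC scaleC_add_left)
  show assoc: "c *\<^sub>C (d *\<^sub>C f) = (c * d) *\<^sub>C f" for c d and f :: "'a \<Rightarrow>\<^sub>C 'b"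
    by (rule bcontfun_eqI) (simp add: apply_bcontfun_scaleC scaleC_scaleC)
  show real: "complex_of_real r *\<^sub>C f = r *\<^sub>R f" for r and f :: "'a \<Rightarrow>\<^sub>C 'b"
    by (rule bcontfun_eqI) (simp add: apply_bcontfun_scaleC scaleC_of_real)
  have le: "norm (c *\<^sub>C f) \<le> cmod c * norm f" for c and f :: "'a \<Rightarrow>\<^sub>C 'b"
    by (rule norm_bound)
      (simp add: apply_bcontfun_scaleC norm_scaleC mult_left_mono norm_bounded)
  show "norm (c *\<^sub>C f) = cmod c * norm f"
  proof (cases "c = 0")
    case True
    then show ?thesis using le[of 0 f] by simp
  next
    case False
    have "f = inverse c *\<^sub>C (c *\<^sub>C f)"
      using False real[of 1 f] by (simp add: assoc)
    then have "norm f \<le> cmod (inverse c) * norm (c *\<^sub>C f)"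
      using le[of "inverse c" "c *\<^sub>C f"] by simp
    then have "cmod c * norm f \<le> cmod c * (cmod (inverse c) * norm (c *\<^sub>C f))"
      by (rule mult_left_mono) simp
    then have "cmod c * norm f \<le> norm (c *\<^sub>C f)"
      using False by (simp add: norm_inverse flip: mult.assoc)
    then show ?thesis using le[of c f] by simp
  qed
qed

end

instance bcontfun :: (metric_space, complex_banach) complex_banach ..

text \<open>
  Holomorphic means complex Frechet differentiable at every point of the open set \<open>U\<close>.
\<close>

definition cholomorphic_on ::
    "('a::complex_normed_vector \<Rightarrow> 'b::complex_normed_vector) \<Rightarrow> 'a set \<Rightarrow> bool"
  where "cholomorphic_on f U \<longleftrightarrow>
    (\<forall>x\<in>U. \<exists>D. (f has_derivative D) (at x) \<and> (\<forall>c h. D (c *\<^sub>C h) = c *\<^sub>C D h))"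

text \<open>
  In the definition of \<open>A_b\<close>, the function \<open>f\<close> is transported to \<open>'x\<close> along \<^const>\<open>Abs_unit_ball\<close>.
  This makes it unspecified outside the closed ball, but differentiability at an interior point
  depends only on the values near that point.
\<close>

definition C_b :: "('x::complex_banach unit_ball \<Rightarrow>\<^sub>C 'y::complex_banach) set"
  where "C_b = UNIV"

definition A_b :: "('x::complex_banach unit_ball \<Rightarrow>\<^sub>C 'y::complex_banach) set"
  where "A_b = {f \<in> C_b.
    cholomorphic_on (\<lambda>x. apply_bcontfun f (Abs_unit_ball x)) (interior (cball 0 1))}"

definition A_u :: "('x::complex_banach unit_ball \<Rightarrow>\<^sub>C 'y::complex_banach) set"
  where "A_u = {f \<in> A_b. uniformly_continuous_on UNIV (apply_bcontfun f)}"

lemma csubspace_C_b: "csubspace C_b"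
  by (simp add: csubspace_def C_b_def)

lemma csubspace_A_b:
  "csubspace (A_b :: ('a::complex_banach unit_ball \<Rightarrow>\<^sub>C 'b::complex_banach) set)"
proof -
  have add: "\<exists>D. ((\<lambda>x. f x + g x) has_derivative D) (at x) \<and> (\<forall>c h. D (c *\<^sub>C h) = c *\<^sub>C D h)"
    if "(f has_derivative D) (at x)" "\<forall>c h. D (c *\<^sub>C h) = c *\<^sub>C D h"
      and "(g has_derivative E) (at x)" "\<forall>c h. E (c *\<^sub>C h) = c *\<^sub>C E h"
    for f g D E :: "'a \<Rightarrow> 'b" and x
    using has_derivative_add[OF that(1,3)] that(2,4)
    by (intro exI[of _ "\<lambda>h. D h + E h"]) (simp add: scaleC_add_right)
  have scale: "\<exists>E. ((\<lambda>x. c *\<^sub>C f x) has_derivative E) (at x) \<and> (\<forall>c h. E (c *\<^sub>C h) = c *\<^sub>C E h)"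
    if "(f has_derivative D) (at x)" "\<forall>c h. D (c *\<^sub>C h) = c *\<^sub>C D h"
    for f D :: "'a \<Rightarrow> 'b" and x c
    using bounded_linear.has_derivative[OF bounded_linear_scaleC[of c] that(1)] that(2)
    by (intro exI[of _ "\<lambda>h. c *\<^sub>C D h"]) (simp add: scaleC_scaleC mult.commute)
  have zero: "c *\<^sub>C (0::'b) = 0" for c
    using norm_scaleC[of c "0::'b"] by simp
  show ?thesis
    unfolding csubspace_def A_b_def cholomorphic_on_def C_b_def
  proof (intro conjI ballI allI, goal_cases)
    case 1
    then show ?case by (auto intro!: exI[of _ "\<lambda>_. 0"] simp: zero)
  next
    case (2 f g)
    show ?case
    proof (clarsimp, goal_cases)
      case (1 x)
      then have "x \<in> interior (cball 0 1)" by simp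
      with 2 obtain D E where
        "((\<lambda>x. f (Abs_unit_ball x)) has_derivative D) (at x)" "\<forall>c h. D (c *\<^sub>C h) = c *\<^sub>C D h"
        "((\<lambda>x. g (Abs_unit_ball x)) has_derivative E) (at x)" "\<forall>c h. E (c *\<^sub>C h) = c *\<^sub>C E h"
        by blast
      then show ?case by (rule add)
    qed
  next
    case (3 c f)
    show ?case
    proof (clarsimp simp: apply_bcontfun_scaleC, goal_cases)
      case (1 x)
      then have "x \<in> interior (cball 0 1)" by simp
      with 3 obtain D where
        "((\<lambda>x. f (Abs_unit_ball x)) has_derivative D) (at x)" "\<forall>c h. D (c *\<^sub>C h) = c *\<^sub>C D h"
        by blast
      then show ?case by (rule scale)
    qed
  qed
qed

lemma csubspace_A_u: "csubspace A_u"
proof -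
  have "uniformly_continuous_on UNIV (apply_bcontfun (c *\<^sub>C f))"
    if "uniformly_continuous_on UNIV (apply_bcontfun f)"
    for c and f :: "'a::complex_banach unit_ball \<Rightarrow>\<^sub>C 'b::complex_banach"
    using bounded_linear.uniformly_continuous_on[OF bounded_linear_scaleC that]
    by (simp add: apply_bcontfun_scaleC[abs_def])
  moreover have "uniformly_continuous_on UNIV (apply_bcontfun (f + g))"
    if "uniformly_continuous_on UNIV (apply_bcontfun f)"
      "uniformly_continuous_on UNIV (apply_bcontfun g)"
    for f g :: "'a::complex_banach unit_ball \<Rightarrow>\<^sub>C 'b::complex_banach"
    using uniformly_continuous_on_add[OF that] by (simp add: plus_bcontfun.rep_eq)
  moreover have "uniformly_continuous_on UNIV
      (apply_bcontfun (0 :: 'a::complex_banach unit_ball \<Rightarrow>\<^sub>C 'b::complex_banach))"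
    using uniformly_continuous_on_const by (simp add: zero_bcontfun.rep_eq)
  ultimately show ?thesis
    using csubspace_A_b unfolding csubspace_def A_u_def by blast
qed

end

theory Submission
  imports Defs
begin

text \<open>
  By Hahn-Banach there are \<open>z\<close> and a complex functional \<open>\<psi>\<close> on \<open>X\<close> with \<open>\<parallel>\<psi>\<parallel> = \<parallel>z\<parallel> = \<psi> z = 1\<close>, so
  functions \<open>q\<close> of the disc algebra pull back to functions \<open>q \<circ> \<psi>\<close> that act by multiplication on
  all three spaces. For a point \<open>t\<close> of the unit circle choose a function \<open>q\<^sub>t\<close> of the disc algebra with
  \<open>q\<^sub>t t = 1\<close>, close to zero away from \<open>t\<close>, and with values so close to \<open>[0, 1]\<close> that
  \<open>\<bar>q\<^sub>t\<bar> + \<bar>1 - q\<^sub>t\<bar> \<le> 1 + \<delta>\<close>. Given \<open>f\<close> in the unit ball and a unit vector \<open>y\<close> of \<open>Y\<close>, the two functions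
  \<open>((1 - q\<^sub>t) f \<plusminus> q\<^sub>t y) / (1 + \<delta>)\<close> lie in the unit ball at distance at least \<open>2 / (1 + \<delta>)\<close>. For \<open>N\<close>
  points \<open>t\<close> with peaks narrow enough, \<open>\<Sum>\<^sub>t \<bar>q\<^sub>t\<bar> \<le> 2\<close>, which forces \<open>q\<^sub>t f\<close> and \<open>q\<^sub>t y\<close> to be weakly small for
  some \<open>t\<close> once \<open>N\<close> is large.
\<close>

section \<open>The Hahn-Banach theorem\<close>

definition sublinear :: "('a::real_vector \<Rightarrow> real) \<Rightarrow> bool"
  where "sublinear p \<longleftrightarrow>
    (\<forall>x y. p (x + y) \<le> p x + p y) \<and> (\<forall>r\<ge>0. \<forall>x. p (r *\<^sub>R x) = r * p x)"

lemma sublinear_add: "sublinear p \<Longrightarrow> p (x + y) \<le> p x + p y"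
  and sublinear_scaleR: "sublinear p \<Longrightarrow> 0 \<le> r \<Longrightarrow> p (r *\<^sub>R x) = r * p x"
  by (auto simp: sublinear_def)

lemma sublinear_zero: "sublinear p \<Longrightarrow> p 0 = 0"
  using sublinear_scaleR[of p 0 0] by simp

lemma sublinear_minus: "sublinear p \<Longrightarrow> - p (- x) \<le> p x"
  using sublinear_add[of p x "- x"] sublinear_zero[of p] by simp

text \<open>The missing inequality comes from \<open>scale\<close> with \<open>inverse r\<close> at
  \<open>r *\<^sub>R x\<close>, so infima need estimating in one direction only.\<close>

lemma sublinearI_le:
  assumes add: "\<And>x y. p (x + y) \<le> p x + p y"
    and zero: "p 0 = 0"
    and scale: "\<And>r x. 0 < r \<Longrightarrow> p (r *\<^sub>R x) \<le> r * p x"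
  shows "sublinear p"
  unfolding sublinear_def
proof (intro conjI allI impI add)
  fix r :: real and x assume "0 \<le> r"
  show "p (r *\<^sub>R x) = r * p x"
  proof (cases "r = 0")
    case True
    then show ?thesis by (simp add: zero)
  next
    case False
    with \<open>0 \<le> r\<close> have r: "0 < r" by simp
    have "r * p x \<le> p (r *\<^sub>R x)"
      using scale[of "inverse r" "r *\<^sub>R x"] r by (simp add: field_simps)
    with scale[OF r, of x] show ?thesis by simp
  qed
qed

text \<open>The witness is the infimum of \<open>p (y + t *\<^sub>R x) - t * p x\<close> over
  \<open>t \<ge> 0\<close>: the value at \<open>t = 0\<close> keeps it below \<open>p\<close>, the
  value at \<open>t = 1\<close> gives the bound at \<open>- x\<close>. It is finite because
  \<open>- p (- y)\<close> is a lower bound.\<close>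

lemma sublinear_shift:
  assumes p: "sublinear p"
  obtains q where "sublinear q" "\<And>y. q y \<le> p y" "q (- x) \<le> - p x"
proof -
  define h where "h y t = p (y + t *\<^sub>R x) - t * p x" for y t
  define q where "q y = (INF t\<in>{0..}. h y t)" for y
  have h_lower: "- p (- y) \<le> h y t" if "0 \<le> t" for y t
    using sublinear_add[OF p, of "y + t *\<^sub>R x" "- y"] sublinear_scaleR[OF p that, of x]
    by (simp add: h_def)
  have bdd: "bdd_below (h y ` {0..})" for y
    by (rule bdd_belowI2[of _ "- p (- y)"]) (simp add: h_lower)
  have q_le: "q y \<le> h y t" if "0 \<le> t" for y t
    unfolding q_def using bdd that by (intro cINF_lower) auto
  have q_greatest: "c \<le> q y" if "\<And>t. 0 \<le> t \<Longrightarrow> c \<le> h y t" for c y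
    unfolding q_def using that by (intro cINF_greatest) auto
  have "sublinear q"
  proof (rule sublinearI_le)
    fix y z
    \<comment> \<open>Parameters \<open>s\<close> for \<open>y\<close> and \<open>t\<close> for
      \<open>z\<close> combine to \<open>s + t\<close>; the two infima are then taken one after the
      other.\<close>
    have h_add: "q (y + z) \<le> h y s + h z t" if "0 \<le> s" "0 \<le> t" for s t
    proof -
      have "q (y + z) \<le> h (y + z) (s + t)" using that by (intro q_le) simp
      also have "\<dots> \<le> h y s + h z t"
        using sublinear_add[OF p, of "y + s *\<^sub>R x" "z + t *\<^sub>R x"]
        by (simp add: h_def algebra_simps)
      finally show ?thesis .
    qed
    have "q (y + z) - h y s \<le> q z" if "0 \<le> s" for s
      using h_add[OF that] by (intro q_greatest) (simp add: algebra_simps)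
    then have "q (y + z) - q z \<le> q y"
      by (intro q_greatest) (simp add: algebra_simps)
    then show "q (y + z) \<le> q y + q z" by simp
  next
    have "h 0 t = 0" if "0 \<le> t" for t
      using sublinear_scaleR[OF p that] by (simp add: h_def)
    then show "q 0 = 0"
      using q_le[of 0 0] q_greatest[of 0 0] by simp
  next
    fix r :: real and y assume r: "0 < r"
    have "q (r *\<^sub>R y) / r \<le> h y t" if "0 \<le> t" for t
    proof -
      \<comment> \<open>Scaling by \<open>r\<close> is absorbed by rescaling the parameter to
        \<open>r * t\<close>.\<close>
      have "q (r *\<^sub>R y) \<le> h (r *\<^sub>R y) (r * t)" using r that by (intro q_le) simp
      also have "\<dots> = p (r *\<^sub>R (y + t *\<^sub>R x)) - r * (t * p x)"
        by (simp add: h_def algebra_simps)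
      also have "\<dots> = r * h y t"
        using r sublinear_scaleR[OF p, of r "y + t *\<^sub>R x"] by (simp add: h_def algebra_simps)
      finally show ?thesis using r by (simp add: field_simps)
    qed
    then have "q (r *\<^sub>R y) / r \<le> q y" by (rule q_greatest)
    then show "q (r *\<^sub>R y) \<le> r * q y" using r by (simp add: field_simps)
  qed
  moreover have "q y \<le> p y" for y using q_le[of 0 y] by (simp add: h_def)
  moreover have "q (- x) \<le> - p x"
    using q_le[of 1 "- x"] sublinear_zero[OF p] by (simp add: h_def)
  ultimately show ?thesis using that by blast
qed

text \<open>Zorn's lemma on the sublinear functionals below \<open>p\<close>: a nonempty chain is
  bounded by its pointwise infimum.\<close>

lemma sublinear_minimal:
  assumes p: "sublinear p"
  obtains m where "sublinear m" "\<And>x. m x \<le> p x"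
    "\<And>q. sublinear q \<Longrightarrow> (\<And>x. q x \<le> m x) \<Longrightarrow> q = m"
proof -
  define A where "A = {q. sublinear q \<and> (\<forall>x. q x \<le> p x)}"
  \<comment> \<open>The order is reversed, so that a maximal element for Zorn is minimal
    pointwise.\<close>
  define P where "P = (\<lambda>a b :: 'a \<Rightarrow> real. \<forall>x. b x \<le> a x)"
  \<comment> \<open>A lower bound common to all candidates makes the infima over chains
    finite.\<close>
  have lower: "- p (- x) \<le> a x" if "a \<in> A" for a x
    using that sublinear_minus[of a x] by (auto simp: A_def intro: order_trans[of _ "- a (- x)"])
  have "\<exists>u\<in>A. \<forall>a\<in>C. P a u" if C: "C \<in> Chains (relation_of P A)" for C
  proof (cases "C = {}")
    case True
    then show ?thesis using p by (auto simp: A_def)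
  next
    case False
    have CA: "C \<subseteq> A" using C by (rule Chains_relation_of)
    define u where "u x = (INF a\<in>C. a x)" for x
    have bdd: "bdd_below ((\<lambda>a. a x) ` C)" for x
      using lower CA by (intro bdd_belowI2[of _ "- p (- x)"]) auto
    have u_le: "u x \<le> a x" if "a \<in> C" for a x
      unfolding u_def using bdd that by (rule cINF_lower)
    have u_greatest: "c \<le> u x" if "\<And>a. a \<in> C \<Longrightarrow> c \<le> a x" for c x
      unfolding u_def using False that by (rule cINF_greatest)
    have sub: "sublinear a" if "a \<in> C" for a using that CA by (auto simp: A_def)
    have "sublinear u"
    proof (rule sublinearI_le)
      fix x y
      have u_add: "u (x + y) \<le> a x + b y" if ab: "a \<in> C" "b \<in> C" for a b
      proof -
        \<comment> \<open>Of two comparable members the smaller one serves for both arguments; this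
          is where the chain property enters.\<close>
        obtain c where "c \<in> C" "P a c" "P b c"
        proof -
          have "P a b \<or> P b a" using C ab by (auto simp: Chains_def relation_of_def)
          then show ?thesis using ab that by (auto simp: P_def)
        qed
        then show ?thesis
          using u_le[of c "x + y"] sublinear_add[OF sub, of c x y] add_mono[of "c x" "a x" "c y" "b y"]
          by (auto simp: P_def)
      qed
      have "u (x + y) - a x \<le> u y" if "a \<in> C" for a
        using u_add[OF that] by (intro u_greatest) (simp add: algebra_simps)
      then have "u (x + y) - u y \<le> u x"
        by (intro u_greatest) (simp add: algebra_simps)
      then show "u (x + y) \<le> u x + u y" by simp
    next
      show "u 0 = 0"
        using False u_le[of _ 0] u_greatest[of 0 0] sublinear_zero[OF sub] by force
    next
      fix r :: real and x assume r: "0 < r"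
      have "u (r *\<^sub>R x) / r \<le> a x" if "a \<in> C" for a
        using u_le[OF that, of "r *\<^sub>R x"] sublinear_scaleR[OF sub[OF that], of r x] r
        by (simp add: field_simps)
      then have "u (r *\<^sub>R x) / r \<le> u x" by (rule u_greatest)
      then show "u (r *\<^sub>R x) \<le> r * u x" using r by (simp add: field_simps)
    qed
    moreover have "u x \<le> p x" for x
      using False CA u_le by (force simp: A_def intro: order_trans)
    ultimately show ?thesis using u_le by (intro bexI[of _ u]) (auto simp: A_def P_def)
  qed
  moreover have "partial_order_on A (relation_of P A)"
    by (rule partial_order_on_relation_ofI) (auto simp: P_def fun_eq_iff intro: order_trans antisym)
  ultimately obtain m where m: "m \<in> A" "\<forall>a\<in>A. P m a \<longrightarrow> a = m"
    using predicate_Zorn[of A P] by blast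
  show ?thesis
  proof (rule that)
    fix q assume "sublinear q" "\<And>x. q x \<le> m x"
    with m show "q = m" by (auto simp: A_def P_def intro: order_trans)
  qed (use m in \<open>auto simp: A_def\<close>)
qed

text \<open>
  A minimal sublinear functional is linear: shifting it in the direction \<open>x\<close> as in
  \<open>sublinear_shift\<close> cannot make it smaller.
\<close>

lemma Hahn_Banach_sublinear:
  assumes p: "sublinear p"
  obtains u where "linear u" "\<And>x. u x \<le> p x" "u z = p z"
proof -
  \<comment> \<open>Shifting towards \<open>z\<close> before minimising fixes the value at
    \<open>z\<close>: a linear \<open>u\<close> below \<open>q\<close> has
    \<open>u (- z) \<le> - p z\<close>, hence \<open>p z \<le> u z\<close>.\<close>
  obtain q where q: "sublinear q" "\<And>y. q y \<le> p y" "q (- z) \<le> - p z"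
    using sublinear_shift[OF p] by blast
  obtain u where u: "sublinear u" "\<And>x. u x \<le> q x"
    and minimal: "\<And>q. sublinear q \<Longrightarrow> (\<And>x. q x \<le> u x) \<Longrightarrow> q = u"
    using sublinear_minimal[OF q(1)] by blast
  have minus: "u (- x) = - u x" for x
  proof -
    obtain v where "sublinear v" "\<And>y. v y \<le> u y" "v (- x) \<le> - u x"
      using sublinear_shift[OF u(1)] by blast
    with minimal have "u (- x) \<le> - u x" by blast
    with sublinear_minus[OF u(1), of x] show ?thesis by simp
  qed
  \<comment> \<open>Since \<open>u\<close> is odd, subadditivity at \<open>- x\<close> and
    \<open>- y\<close> is the reverse of subadditivity at \<open>x\<close> and
    \<open>y\<close>.\<close>
  have "u (x + y) = u x + u y" for x y
    using sublinear_add[OF u(1), of x y] sublinear_add[OF u(1), of "- x" "- y"] minus[of "x + y"]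
    by (simp add: minus)
  moreover have "u (r *\<^sub>R x) = r * u x" for r x
    using sublinear_scaleR[OF u(1), of r x] sublinear_scaleR[OF u(1), of "- r" x]
      minus[of "r *\<^sub>R x"] by (cases "0 \<le> r") auto
  ultimately have "linear u" by (intro linearI) auto
  moreover have le: "u x \<le> p x" for x using u(2) q(2) order_trans by blast
  moreover have "u z = p z"
    using u(2)[of "- z"] q(3) minus[of z] le[of z] by simp
  ultimately show ?thesis using that by blast
qed

text \<open>A real functional \<open>u\<close> of Hahn-Banach is the real part of a unique
  complex-linear one, whose imaginary part at \<open>x\<close> must be
  \<open>- u (\<i> *\<^sub>C x)\<close>.\<close>

lemma norming_functional:
  fixes z :: "'a::complex_normed_vector"
  obtains \<psi> :: "'a \<Rightarrow> complex"
  where "\<And>x y. \<psi> (x + y) = \<psi> x + \<psi> y" "\<And>c x. \<psi> (c *\<^sub>C x) = c * \<psi> x"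
    "\<And>x. cmod (\<psi> x) \<le> norm x" "\<psi> z = of_real (norm z)"
proof -
  have "sublinear (norm :: 'a \<Rightarrow> real)"
    by (auto simp: sublinear_def norm_triangle_ineq)
  then obtain u :: "'a \<Rightarrow> real"
    where u: "linear u" "\<And>x. u x \<le> norm x" "u z = norm z"
    using Hahn_Banach_sublinear by blast
  define \<psi> where "\<psi> x = Complex (u x) (- u (\<i> *\<^sub>C x))" for x
  have add: "\<psi> (x + y) = \<psi> x + \<psi> y" for x y
    by (simp add: \<psi>_def scaleC_add_right linear_add[OF u(1)] complex_eq_iff)
  have u_scaleC: "u (c *\<^sub>C x) = Re c * u x + Im c * u (\<i> *\<^sub>C x)" for c x
  proof -
    have "c *\<^sub>C x = (of_real (Re c) + of_real (Im c) * \<i>) *\<^sub>C x"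
      by (metis complex_eq mult.commute)
    also have "\<dots> = Re c *\<^sub>R x + Im c *\<^sub>R (\<i> *\<^sub>C x)"
      by (simp only: scaleC_add_left scaleC_of_real flip: scaleC_scaleC)
    finally show ?thesis by (simp add: linear_add[OF u(1)] linear_cmul[OF u(1)])
  qed
  have scale: "\<psi> (c *\<^sub>C x) = c * \<psi> x" for c x
    by (simp add: \<psi>_def complex_eq_iff scaleC_scaleC u_scaleC[of c] u_scaleC[of "\<i> * c"]
        algebra_simps)
  have bound: "cmod (\<psi> x) \<le> norm x" for x
  proof (cases "\<psi> x = 0")
    case False
    \<comment> \<open>This unimodular factor rotates \<open>\<psi> x\<close> onto the positive axis,
      where modulus and real part agree, so the bound on \<open>u\<close> carries over.\<close>
    define c where "c = cnj (\<psi> x) / of_real (cmod (\<psi> x))"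
    have "\<psi> (c *\<^sub>C x) = of_real (cmod (\<psi> x))"
      using False complex_norm_square[of "\<psi> x"]
      by (simp add: scale c_def field_simps power2_eq_square)
    then have "cmod (\<psi> x) = u (c *\<^sub>C x)"
      by (simp add: \<psi>_def complex_eq_iff)
    also have "\<dots> \<le> norm (c *\<^sub>C x)" by (rule u(2))
    also have "\<dots> = norm x" using False by (simp add: norm_scaleC c_def norm_divide)
    finally show ?thesis .
  qed simp
  \<comment> \<open>The real part already exhausts the bound on the modulus, so the imaginary part
    vanishes.\<close>
  have "Re (\<psi> z) = norm z" by (simp add: \<psi>_def u(3))
  moreover have "(Re (\<psi> z))\<^sup>2 + (Im (\<psi> z))\<^sup>2 \<le> (norm z)\<^sup>2"
    using power_mono[OF bound[of z], of 2] by (simp add: cmod_power2)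
  ultimately have "\<psi> z = of_real (norm z)" by (simp add: complex_eq_iff)
  with add scale bound show ?thesis using that by blast
qed

section \<open>Peak functions on the disc\<close>

text \<open>
  For \<open>w = 1 - cnj t * z\<close>, which has nonnegative real part on the disc, \<open>u = n * w powr e\<close> lies in a
  thin sector around the positive axis when \<open>e\<close> is small; there \<open>1 + \<bar>u\<bar>\<close> is almost \<open>\<bar>1 + u\<bar>\<close>, which is
  the required bound for \<open>q = 1 / (1 + u)\<close>.
\<close>

lemma peak_function:
  fixes t :: complex and \<delta> r \<eta> :: real
  assumes t: "cmod t = 1" and pos: "0 < \<delta>" "0 < r" "0 < \<eta>"
  obtains q :: "complex \<Rightarrow> complex"
  where "continuous_on (cball 0 1) q" "\<And>z. z \<in> ball 0 1 \<Longrightarrow> q field_differentiable (at z)"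
    "q t = 1" "\<And>z. z \<in> cball 0 1 \<Longrightarrow> cmod (q z) \<le> 1"
    "\<And>z. z \<in> cball 0 1 \<Longrightarrow> cmod (1 - q z) + cmod (q z) \<le> 1 + \<delta>"
    "\<And>z. z \<in> cball 0 1 \<Longrightarrow> r \<le> dist z t \<Longrightarrow> cmod (q z) \<le> \<eta>"
proof -
  \<comment> \<open>The sector has half-angle \<open>e * (pi / 2)\<close>; for small
    \<open>e\<close> its cosine exceeds \<open>1 / (1 + \<delta>)\<close>.\<close>
  have "((\<lambda>e. cos (e * (pi / 2))) \<longlongrightarrow> cos (0 * (pi / 2))) (at_right 0)"
    by (intro tendsto_intros)
  moreover have "1 / (1 + \<delta>) < cos (0 * (pi / 2))"
    using pos by (simp add: divide_less_eq)
  ultimately have "\<forall>\<^sub>F e in at_right 0. 1 / (1 + \<delta>) < cos (e * (pi / 2))"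
    by (rule order_tendstoD(1))
  moreover have "\<forall>\<^sub>F e in at_right 0. e < (1::real)"
    using eventually_at_right_real[of 0 1] by (auto elim: eventually_mono)
  moreover have "\<forall>\<^sub>F e in at_right 0. (0::real) < e"
    by (rule eventually_at_right_less)
  ultimately have "\<forall>\<^sub>F e in at_right 0. 0 < e \<and> e < 1 \<and> 1 / (1 + \<delta>) < cos (e * (pi / 2))"
    by eventually_elim simp
  then obtain e where e: "0 < e" "e < 1" "1 / (1 + \<delta>) < cos (e * (pi / 2))"
    using eventually_happens'[OF trivial_limit_at_right_real] by blast
  define c where "c = cos (e * (pi / 2))"
  have c: "0 < c" "c \<le> 1" "1 / c \<le> 1 + \<delta>"
  proof -
    have "0 < 1 / (1 + \<delta>)" using pos by simp
    with e(3) show "0 < c" unfolding c_def by linarith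
    moreover have "1 / (1 + \<delta>) < c" using e(3) by (simp add: c_def)
    ultimately show "1 / c \<le> 1 + \<delta>" using pos by (simp add: field_simps)
  qed (simp add: c_def)
  \<comment> \<open>This factor makes \<open>c * cmod (u z) \<ge> 1 / \<eta>\<close> at distance at
    least \<open>r\<close> from \<open>t\<close>, where \<open>cmod (w z) \<ge> r\<close>.\<close>
  define n where "n = 1 / (\<eta> * c * r powr e)"
  have n: "0 < n" using pos c by (simp add: n_def)
  define w where "w z = 1 - cnj t * z" for z
  define u where "u z = of_real n * (w z powr of_real e)" for z
  define q where "q z = 1 / (1 + u z)" for z
  have tt: "cnj t * t = 1"
    using complex_norm_square[of t] t by (metis mult.commute of_real_1 one_power2)
  have norm_w: "cmod (w z) = dist z t" for z
  proof -
    have "w z = cnj t * (t - z)" by (simp add: w_def tt right_diff_distrib)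
    then show ?thesis using t by (simp add: norm_mult dist_norm norm_minus_commute)
  qed
  have Re_w: "1 - cmod z \<le> Re (w z)" for z
    using complex_Re_le_cmod[of "cnj t * z"] t by (simp add: w_def norm_mult)
  have Re_u: "c * cmod (u z) \<le> Re (u z)" if "0 \<le> Re (w z)" for z
  proof (cases "w z = 0")
    case False
    \<comment> \<open>The power multiplies the argument, at most \<open>pi / 2\<close> in modulus
      here, by \<open>e\<close>; the cosine therefore stays at least \<open>c\<close>.\<close>
    have arg: "\<bar>Im (Ln (w z))\<bar> \<le> pi / 2" using Re_Ln_pos_le[OF False] that by simp
    have "Re (w z powr of_real e) = cmod (w z powr of_real e) * cos (e * Im (Ln (w z)))"
      using False by (simp add: powr_def Re_exp norm_exp_eq_Re)
    moreover have "c \<le> cos (e * Im (Ln (w z)))"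
    proof -
      have "c \<le> cos \<bar>e * Im (Ln (w z))\<bar>"
        unfolding c_def using arg e
        by (intro cos_monotone_0_pi_le)
          (auto simp: abs_mult mult_le_cancel_left_pos intro!: order_trans[of _ "1 * (pi/2)"] mult_mono)
      then show ?thesis by (simp only: cos_abs_real)
    qed
    ultimately show ?thesis
      using n by (simp add: u_def norm_mult mult.left_commute[of c])
        (simp add: mult.commute[of c] mult_left_mono)
  qed (simp add: u_def)
  have Re_u_nonneg: "0 \<le> Re (u z)" if "0 \<le> Re (w z)" for z
    using Re_u[OF that] c by (meson mult_nonneg_nonneg norm_ge_zero order_trans less_imp_le)
  have denom: "1 + c * cmod (u z) \<le> cmod (1 + u z)" if "0 \<le> Re (w z)" for z
    using Re_u[OF that] complex_Re_le_cmod[of "1 + u z"] by simp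
  have denom_pos: "0 < cmod (1 + u z)" "1 + u z \<noteq> 0" if "0 \<le> Re (w z)" for z
  proof -
    show "0 < cmod (1 + u z)" using denom[OF that] c
      by (smt (verit) mult_nonneg_nonneg norm_ge_zero)
    then show "1 + u z \<noteq> 0" by auto
  qed
  have in_disc: "0 \<le> Re (w z)" if "z \<in> cball 0 1" for z
    using Re_w[of z] that by simp
  show ?thesis
  proof (rule that[of q])
    have "continuous_on (cball 0 1) w"
      unfolding w_def by (intro continuous_intros)
    \<comment> \<open>Continuity extends to the branch point \<open>w z = 0\<close>, reached at
      \<open>z = t\<close>, because the exponent is positive.\<close>
    then have "continuous_on (cball 0 1) (\<lambda>z. w z powr of_real e)"
      using in_disc e by (intro continuous_on_powr_complex continuous_intros) auto
    then show "continuous_on (cball 0 1) q"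
      unfolding q_def u_def using denom_pos(2)[OF in_disc]
      by (intro continuous_on_divide continuous_on_add continuous_on_mult continuous_on_const)
        (auto simp: u_def)
  next
    fix z :: complex assume z: "z \<in> ball 0 1"
    \<comment> \<open>Inside the disc the real part is strictly positive, which keeps
      \<open>w z\<close> off the branch cut.\<close>
    then have "0 < Re (w z)" using Re_w[of z] by simp
    then have "w z \<notin> \<real>\<^sub>\<le>\<^sub>0" by (auto simp: complex_nonpos_Reals_iff)
    moreover have "(w has_field_derivative - cnj t) (at z)"
      unfolding w_def by (auto intro!: derivative_eq_intros)
    ultimately have "((\<lambda>z. w z powr of_real e) has_field_derivative
        (of_real e * w z powr (of_real e - 1)) * - cnj t) (at z)"
      by (intro DERIV_chain2[where f = "\<lambda>z. z powr of_real e" and g = w]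
          has_field_derivative_powr)
    then have "u field_differentiable (at z)"
      unfolding u_def by (intro field_differentiable_mult) (auto simp: field_differentiable_def)
    then show "q field_differentiable (at z)"
      unfolding q_def using denom_pos(2)[OF in_disc] z
      by (intro field_differentiable_divide field_differentiable_add) auto
  next
    show "q t = 1" by (simp add: q_def u_def w_def tt)
  next
    fix z :: complex assume z: "z \<in> cball 0 1"
    note pos_z = denom_pos[OF in_disc[OF z]] and denom_z = denom[OF in_disc[OF z]]
    have "1 \<le> cmod (1 + u z)" using denom_z c by (smt (verit) mult_nonneg_nonneg norm_ge_zero)
    then show "cmod (q z) \<le> 1" using pos_z by (simp add: q_def norm_divide divide_le_eq)
    have "cmod (1 - q z) + cmod (q z) = (1 + cmod (u z)) / cmod (1 + u z)"
    proof -
      have "1 - q z = u z / (1 + u z)" using pos_z by (simp add: q_def field_simps)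
      then show ?thesis by (simp add: q_def norm_divide add_divide_distrib)
    qed
    also have "\<dots> \<le> 1 / c"
    proof -
      have "c * (1 + cmod (u z)) \<le> 1 + c * cmod (u z)" using c by (simp add: algebra_simps)
      with denom_z show ?thesis using pos_z c by (simp add: field_simps)
    qed
    finally show "cmod (1 - q z) + cmod (q z) \<le> 1 + \<delta>" using c(3) by simp
    assume "r \<le> dist z t"
    then have "r powr e \<le> cmod (w z) powr e"
      using pos e by (intro powr_mono2) (auto simp: norm_w)
    then have "n * r powr e \<le> cmod (u z)"
      using n by (simp add: u_def norm_mult norm_powr_real_powr')
    then have "c * (n * r powr e) \<le> c * cmod (u z)" using c by simp
    moreover have "c * (n * r powr e) = 1 / \<eta>" using c pos by (simp add: n_def)
    ultimately have "1 / \<eta> \<le> cmod (1 + u z)" using denom_z by simp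
    then show "cmod (q z) \<le> \<eta>" using pos pos_z by (simp add: q_def norm_divide field_simps)
  qed
qed

section \<open>A criterion for the diameter two property\<close>

lemma csubspace_scaleR: "csubspace V \<Longrightarrow> x \<in> V \<Longrightarrow> r *\<^sub>R x \<in> V"
  by (metis csubspace_def scaleC_of_real)

lemma csubspace_add: "csubspace V \<Longrightarrow> x \<in> V \<Longrightarrow> y \<in> V \<Longrightarrow> x + y \<in> V"
  by (simp add: csubspace_def)

lemma csubspace_diff: "csubspace V \<Longrightarrow> x \<in> V \<Longrightarrow> y \<in> V \<Longrightarrow> x - y \<in> V"
  using csubspace_add[of V x "- y"] csubspace_scaleR[of V y "- 1"] by simp

lemma cdual_add: "\<phi> \<in> cdual V \<Longrightarrow> x \<in> V \<Longrightarrow> y \<in> V \<Longrightarrow> \<phi> (x + y) = \<phi> x + \<phi> y"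
  and cdual_scaleC: "\<phi> \<in> cdual V \<Longrightarrow> x \<in> V \<Longrightarrow> \<phi> (c *\<^sub>C x) = c * \<phi> x"
  by (auto simp: cdual_def)

lemma cdual_scaleR: "\<phi> \<in> cdual V \<Longrightarrow> x \<in> V \<Longrightarrow> \<phi> (r *\<^sub>R x) = of_real r * \<phi> x"
  by (metis cdual_scaleC scaleC_of_real)

lemma cdual_diff:
  assumes "csubspace V" "\<phi> \<in> cdual V" "x \<in> V" "y \<in> V"
  shows "\<phi> (x - y) = \<phi> x - \<phi> y"
  using cdual_add[OF assms(2), of x "- y"] cdual_scaleR[OF assms(2,4), of "- 1"]
    csubspace_scaleR[OF assms(1,4), of "- 1"] assms(3) by simp

text \<open>A functional is additive on \<open>V\<close> only, so membership of the partial sums has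
  to accompany the induction.\<close>

lemma cdual_sum:
  assumes V: "csubspace V" and \<phi>: "\<phi> \<in> cdual V" and "finite T" "\<And>t. t \<in> T \<Longrightarrow> a t \<in> V"
  shows "(\<Sum>t\<in>T. c t *\<^sub>C a t) \<in> V \<and> \<phi> (\<Sum>t\<in>T. c t *\<^sub>C a t) = (\<Sum>t\<in>T. c t * \<phi> (a t))"
  using assms(3,4)
proof (induction T)
  case empty
  have "0 \<in> V" using V by (simp add: csubspace_def)
  then show ?case using cdual_scaleR[OF \<phi>, of 0 0] by simp
next
  case (insert t T)
  have "c t *\<^sub>C a t \<in> V" using insert V by (simp add: csubspace_def)
  with insert show ?case
    by (simp add: csubspace_add[OF V] cdual_add[OF \<phi>] cdual_scaleC[OF \<phi>])
qed

text \<open>The maximum of finitely many bounds; starting from 1 keeps it positive, so that it can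
  serve as a divisor.\<close>

lemma cdual_uniform_bound:
  assumes "finite F" "F \<subseteq> cdual V"
  obtains K where "0 < K" "\<And>\<phi> x. \<phi> \<in> F \<Longrightarrow> x \<in> V \<Longrightarrow> cmod (\<phi> x) \<le> K * norm x"
proof -
  have "\<exists>K>0. \<forall>\<phi>\<in>F. \<forall>x\<in>V. cmod (\<phi> x) \<le> K * norm x"
    using assms
  proof (induction F)
    case empty
    show ?case by (rule exI[of _ 1]) simp
  next
    case (insert \<phi> F)
    then obtain K where K: "0 < K" "\<forall>\<phi>\<in>F. \<forall>x\<in>V. cmod (\<phi> x) \<le> K * norm x"
      by auto
    have "\<phi> \<in> cdual V" using insert.prems by simp
    then obtain L where L: "\<forall>x\<in>V. cmod (\<phi> x) \<le> L * norm x"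
      unfolding cdual_def by auto
    have max: "K * norm x \<le> max K L * norm x" "L * norm x \<le> max K L * norm x" for x :: 'a
      by (simp_all add: mult_right_mono)
    with K(2) L have "\<forall>\<psi>\<in>insert \<phi> F. \<forall>x\<in>V. cmod (\<psi> x) \<le> max K L * norm x"
      by (auto intro: order_trans[OF _ max(1)] order_trans[OF _ max(2)])
    moreover have "0 < max K L" using K(1) by simp
    ultimately show ?case by blast
  qed
  then show ?thesis using that by blast
qed

text \<open>Induction over the generation of open sets: intersections take the union of the
  functionals and the smaller radius, unions inherit a neighbourhood from a member.\<close>

lemma weak_topology_neighbourhood:
  assumes "openin (weak_topology V) U" "f \<in> U"
  obtains F \<epsilon> where "finite F" "F \<subseteq> cdual V" "0 < \<epsilon>"
    "\<And>g. g \<in> V \<Longrightarrow> (\<And>\<phi>. \<phi> \<in> F \<Longrightarrow> cmod (\<phi> g - \<phi> f) < \<epsilon>) \<Longrightarrow> g \<in> U"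
proof -
  define nb where "nb U f \<longleftrightarrow> (\<exists>F \<epsilon>. finite F \<and> F \<subseteq> cdual V \<and> 0 < \<epsilon> \<and>
    (\<forall>g\<in>V. (\<forall>\<phi>\<in>F. cmod (\<phi> g - \<phi> f) < \<epsilon>) \<longrightarrow> g \<in> U))" for U f
  have nb_Int: "nb (A \<inter> B) f" if A: "nb A f" and B: "nb B f" for A B f
  proof -
    obtain F \<epsilon> where F: "finite F" "F \<subseteq> cdual V" "0 < \<epsilon>"
      "\<forall>g\<in>V. (\<forall>\<phi>\<in>F. cmod (\<phi> g - \<phi> f) < \<epsilon>) \<longrightarrow> g \<in> A"
      using A unfolding nb_def by (elim exE conjE) (rule that)
    obtain G \<delta> where G: "finite G" "G \<subseteq> cdual V" "0 < \<delta>"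
      "\<forall>g\<in>V. (\<forall>\<phi>\<in>G. cmod (\<phi> g - \<phi> f) < \<delta>) \<longrightarrow> g \<in> B"
      using B unfolding nb_def by (elim exE conjE) (rule that)
    show ?thesis
      unfolding nb_def using F G
      by (intro exI[of _ "F \<union> G"] exI[of _ "min \<epsilon> \<delta>"]) simp
  qed
  have nb_mono: "nb B f" if "nb A f" "A \<subseteq> B" for A B f
    using that unfolding nb_def by (meson subsetD)
  have nb_Basis: "nb {x \<in> V. \<phi> x \<in> S} f"
    if \<phi>: "\<phi> \<in> cdual V" and S: "open S" "\<phi> f \<in> S" for \<phi> S f
  proof -
    obtain \<epsilon> where "0 < \<epsilon>" "\<forall>z. dist z (\<phi> f) < \<epsilon> \<longrightarrow> z \<in> S"
      using S unfolding open_dist by blast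
    then show ?thesis
      unfolding nb_def using \<phi>
      by (intro exI[of _ "{\<phi>}"] exI[of _ \<epsilon>]) (simp add: dist_norm)
  qed
  have "generate_topology_on {{x \<in> V. \<phi> x \<in> S} | \<phi> S. \<phi> \<in> cdual V \<and> open S} U"
    using assms(1) by (simp add: weak_topology_def openin_topology_generated_by_iff)
  then have "nb U f" using assms(2)
  proof induction
    case (Int A B)
    then show ?case by (intro nb_Int) simp_all
  next
    case (UN K)
    then obtain A where "A \<in> K" "f \<in> A" by blast
    then show ?case using UN.IH by (intro nb_mono[of A f "\<Union>K"]) auto
  next
    case (Basis A)
    then obtain \<phi> S where "A = {x \<in> V. \<phi> x \<in> S}" "\<phi> \<in> cdual V" "open S" by auto
    with Basis.prems show ?case by (simp add: nb_Basis)
  qed simp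
  then show ?thesis
    unfolding nb_def using that by metis
qed

text \<open>With phases chosen to make every \<open>c t * \<phi> (a t)\<close> nonnegative, the sum
  of moduli is the value of \<open>\<phi>\<close> at a single combination.\<close>

lemma sum_functional_le:
  assumes V: "csubspace V" and \<phi>: "\<phi> \<in> cdual V"
    and K: "0 \<le> K" "\<And>x. x \<in> V \<Longrightarrow> cmod (\<phi> x) \<le> K * norm x"
    and T: "finite T" "\<And>t. t \<in> T \<Longrightarrow> a t \<in> V"
    and M: "\<And>c. (\<And>t. t \<in> T \<Longrightarrow> cmod (c t) \<le> 1) \<Longrightarrow> norm (\<Sum>t\<in>T. c t *\<^sub>C a t) \<le> M"
  shows "(\<Sum>t\<in>T. cmod (\<phi> (a t))) \<le> K * M"
proof -
  \<comment> \<open>Where \<open>\<phi> (a t) = 0\<close>, \<open>sgn\<close> gives 0, which still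
    satisfies the coefficient bound.\<close>
  define c where "c t = cnj (sgn (\<phi> (a t)))" for t
  have "c t * \<phi> (a t) = of_real (cmod (\<phi> (a t)))" for t
    using complex_norm_square[of "\<phi> (a t)"]
    by (cases "\<phi> (a t) = 0") (simp_all add: c_def sgn_eq field_simps power2_eq_square)
  then have "of_real (\<Sum>t\<in>T. cmod (\<phi> (a t))) = \<phi> (\<Sum>t\<in>T. c t *\<^sub>C a t)"
    using cdual_sum[OF V \<phi> T(1), of a c] T(2) by simp
  then have "(\<Sum>t\<in>T. cmod (\<phi> (a t))) \<le> cmod (\<phi> (\<Sum>t\<in>T. c t *\<^sub>C a t))"
    by (metis complex_Re_le_cmod Re_complex_of_real)
  also have "\<dots> \<le> K * norm (\<Sum>t\<in>T. c t *\<^sub>C a t)"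
    using cdual_sum[OF V \<phi> T(1), of a c] T(2) by (intro K(2)) blast
  also have "\<dots> \<le> K * M"
    using K(1) by (intro mult_left_mono M) (auto simp: c_def norm_sgn)
  finally show ?thesis .
qed

text \<open>
  The bound on all combinations with coefficients in the unit disc makes
  \<open>\<Sum>t\<in>T. \<bar>\<phi> (a t)\<bar>\<close> bounded independently of \<open>N\<close>, so for large \<open>N\<close> some \<open>a t\<close> and \<open>b t\<close> are
  small for the finitely many functionals that define a weak neighbourhood.
\<close>

lemma diameter_two_propertyI:
  fixes V :: "'a::complex_normed_vector set"
  assumes V: "csubspace V"
    and perturb: "\<And>f \<delta> N. \<lbrakk>f \<in> V; norm f \<le> 1; 0 < \<delta>; 0 < N\<rbrakk> \<Longrightarrow>
      \<exists>(T :: 't set) a b. finite T \<and> card T = N \<and>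
        (\<forall>t\<in>T. a t \<in> V \<and> b t \<in> V \<and> 1 \<le> norm (b t) \<and>
          norm (f - a t + b t) \<le> 1 + \<delta> \<and> norm (f - a t - b t) \<le> 1 + \<delta>) \<and>
        (\<forall>c. (\<forall>t\<in>T. cmod (c t) \<le> 1) \<longrightarrow>
          norm (\<Sum>t\<in>T. c t *\<^sub>C a t) \<le> M \<and> norm (\<Sum>t\<in>T. c t *\<^sub>C b t) \<le> M)"
  shows "diameter_two_property V"
  unfolding diameter_two_property_def
proof (intro allI impI)
  fix W assume "openin (subtopology (weak_topology V) (V \<inter> cball 0 1)) W \<and> W \<noteq> {}"
  then obtain U f where U: "openin (weak_topology V) U" "W = U \<inter> (V \<inter> cball 0 1)"
    and f: "f \<in> U" "f \<in> V" "norm f \<le> 1"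
    unfolding openin_subtopology by fastforce
  obtain F \<epsilon> where F: "finite F" "F \<subseteq> cdual V" "0 < \<epsilon>"
    and FU: "\<And>g. g \<in> V \<Longrightarrow> (\<And>\<phi>. \<phi> \<in> F \<Longrightarrow> cmod (\<phi> g - \<phi> f) < \<epsilon>) \<Longrightarrow> g \<in> U"
    using weak_topology_neighbourhood[OF U(1) f(1)] by blast
  obtain K where K: "0 < K" "\<And>\<phi> x. \<phi> \<in> F \<Longrightarrow> x \<in> V \<Longrightarrow> cmod (\<phi> x) \<le> K * norm x"
    using cdual_uniform_bound[OF F(1,2)] by blast
  have bounded: "bounded W" using U(2) by (auto intro: bounded_subset[of "cball 0 1"])
  have lower: "2 / (1 + \<delta>) \<le> diameter W" if \<delta>: "0 < \<delta>" "\<delta> * K < \<epsilon> / 2" for \<delta>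
  proof -
    \<comment> \<open>\<open>L\<close> allows \<open>K * M\<close> for each functional and each of
      the two families, independently of \<open>N\<close>. So \<open>N\<close> can be chosen
      afterwards to push the average of \<open>s\<close> below \<open>\<epsilon> / 2\<close>;
      \<open>max 0\<close> makes \<open>N\<close> positive.\<close>
    define L where "L = card F * (K * M + K * M)"
    obtain N :: nat where N: "L / (\<epsilon> / 2) < N" "0 < N"
      using reals_Archimedean2[of "max 0 (L / (\<epsilon> / 2))"] by auto
    obtain T :: "'t set" and a b where T: "finite T" "card T = N"
      and ab0: "\<forall>t\<in>T. a t \<in> V \<and> b t \<in> V \<and> 1 \<le> norm (b t) \<and>
          norm (f - a t + b t) \<le> 1 + \<delta> \<and> norm (f - a t - b t) \<le> 1 + \<delta>"
      and M0: "\<forall>c. (\<forall>t\<in>T. cmod (c t) \<le> 1) \<longrightarrow>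
          norm (\<Sum>t\<in>T. c t *\<^sub>C a t) \<le> M \<and> norm (\<Sum>t\<in>T. c t *\<^sub>C b t) \<le> M"
      using perturb[OF f(2,3) \<delta>(1) N(2)] by (elim exE conjE) (rule that)
    have ab: "a t \<in> V" "b t \<in> V" "1 \<le> norm (b t)"
      "norm (f - a t + b t) \<le> 1 + \<delta>" "norm (f - a t - b t) \<le> 1 + \<delta>" if "t \<in> T" for t
      using ab0 that by blast+
    have M: "norm (\<Sum>t\<in>T. c t *\<^sub>C a t) \<le> M" "norm (\<Sum>t\<in>T. c t *\<^sub>C b t) \<le> M"
      if "\<And>t. t \<in> T \<Longrightarrow> cmod (c t) \<le> 1" for c
      using M0 that by blast+
    define s where "s t = (\<Sum>\<phi>\<in>F. cmod (\<phi> (a t)) + cmod (\<phi> (b t)))" for t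
    have "(\<Sum>t\<in>T. s t) = (\<Sum>\<phi>\<in>F. (\<Sum>t\<in>T. cmod (\<phi> (a t))) + (\<Sum>t\<in>T. cmod (\<phi> (b t))))"
      unfolding s_def by (subst sum.swap) (simp add: sum.distrib)
    also have "\<dots> \<le> L"
      unfolding L_def of_nat_mult using F K T ab M
      by (intro sum_bounded_above add_mono sum_functional_le[OF V]) auto
    finally have "(\<Sum>t\<in>T. s t) \<le> L" .
    also have "L < N * (\<epsilon> / 2)" using N F(3) by (simp add: field_simps)
    finally have sum_less: "(\<Sum>t\<in>T. s t) < N * (\<epsilon> / 2)" .
    obtain t where t: "t \<in> T" "s t < \<epsilon> / 2"
    proof (rule ccontr)
      assume "\<not> thesis"
      with that have "\<And>t. t \<in> T \<Longrightarrow> \<epsilon> / 2 \<le> s t" by force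
      then have "of_nat (card T) * (\<epsilon> / 2) \<le> (\<Sum>t\<in>T. s t)" by (rule sum_bounded_below)
      with sum_less T(2) show False by simp
    qed
    have small: "cmod (\<phi> (a t)) + cmod (\<phi> (b t)) < \<epsilon> / 2" if "\<phi> \<in> F" for \<phi>
      using member_le_sum[OF that, of "\<lambda>\<phi>. cmod (\<phi> (a t)) + cmod (\<phi> (b t))"] F(1) t(2)
      by (simp add: s_def)
    \<comment> \<open>Only the moduli of \<open>\<phi> d\<close> enter, so \<open>b t\<close> and
      \<open>- b t\<close> are handled at once.\<close>
    have in_W: "(1 / (1 + \<delta>)) *\<^sub>R (f - a t + d) \<in> W"
      if d: "d \<in> V" "\<And>\<phi>. \<phi> \<in> F \<Longrightarrow> cmod (\<phi> d) = cmod (\<phi> (b t))" "norm (f - a t + d) \<le> 1 + \<delta>"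
      for d
    proof -
      let ?h = "f - a t + d"
      let ?g = "(1 / (1 + \<delta>)) *\<^sub>R ?h"
      have hV: "?h \<in> V"
        using V f(2) ab(1)[OF t(1)] d(1) by (intro csubspace_add csubspace_diff)
      then have gV: "?g \<in> V" by (rule csubspace_scaleR[OF V])
      have "cmod (\<phi> ?g - \<phi> f) < \<epsilon>" if "\<phi> \<in> F" for \<phi>
      proof -
        have \<phi>: "\<phi> \<in> cdual V" using that F(2) by blast
        have "complex_of_real (1 / (1 + \<delta>)) * of_real (1 + \<delta>) = 1"
          using \<delta>(1) by (simp del: of_real_add flip: of_real_mult)
        \<comment> \<open>The error splits into \<open>\<phi> d\<close>, \<open>\<phi> (a t)\<close>
          and \<open>of_real \<delta> * \<phi> f\<close>: the choice of \<open>t\<close> keeps the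
          first two together below \<open>\<epsilon> / 2\<close>, the choice of
          \<open>\<delta>\<close> the third.\<close>
        then have "\<phi> ?g - \<phi> f = of_real (1 / (1 + \<delta>)) * (\<phi> ?h - of_real (1 + \<delta>) * \<phi> f)"
          by (simp only: cdual_scaleR[OF \<phi> hV] right_diff_distrib mult_1_left flip: mult.assoc)
        also have "\<phi> ?h - of_real (1 + \<delta>) * \<phi> f = \<phi> d - \<phi> (a t) - of_real \<delta> * \<phi> f"
        proof -
          have "\<phi> ?h = \<phi> f - \<phi> (a t) + \<phi> d"
            using f(2) ab(1)[OF t(1)] d(1)
            by (simp add: cdual_add[OF \<phi>] cdual_diff[OF V \<phi>] csubspace_diff[OF V])
          then show ?thesis by (simp add: algebra_simps)
        qed
        finally have "cmod (\<phi> ?g - \<phi> f) =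
            1 / (1 + \<delta>) * cmod (\<phi> d - \<phi> (a t) - of_real \<delta> * \<phi> f)"
          using \<delta>(1) by (simp only: norm_mult norm_of_real) simp
        also have "\<dots> \<le> 1 * cmod (\<phi> d - \<phi> (a t) - of_real \<delta> * \<phi> f)"
          using \<delta>(1) by (intro mult_right_mono) auto
        also have "\<dots> \<le> cmod (\<phi> d) + cmod (\<phi> (a t)) + \<delta> * cmod (\<phi> f)"
          using norm_triangle_ineq4[of "\<phi> d - \<phi> (a t)" "of_real \<delta> * \<phi> f"]
            norm_triangle_ineq4[of "\<phi> d" "\<phi> (a t)"] \<delta>(1) by (simp add: norm_mult)
        also have "\<delta> * cmod (\<phi> f) \<le> \<delta> * (K * 1)"
          using K(2)[OF that f(2)] f(3) K(1) \<delta>(1)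
          by (intro mult_left_mono order_trans[OF K(2)[OF that f(2)]]) auto
        finally show ?thesis using small[OF that] \<delta>(2) d(2)[OF that] by simp
      qed
      then have "?g \<in> U" using gV by (intro FU)
      moreover have "norm ?g \<le> 1"
        using d(3) \<delta>(1) unfolding norm_scaleR by (simp add: field_simps)
      ultimately show ?thesis using gV by (simp add: U(2))
    qed
    have bt: "b t \<in> V" using ab(2) t(1) .
    have neg: "\<phi> (- b t) = - \<phi> (b t)" if "\<phi> \<in> F" for \<phi>
      using cdual_scaleR[of \<phi> V "b t" "- 1"] that F(2) bt by auto
    have "(1 / (1 + \<delta>)) *\<^sub>R (f - a t + b t) \<in> W"
      using bt ab(4)[OF t(1)] by (intro in_W) auto
    moreover have "(1 / (1 + \<delta>)) *\<^sub>R (f - a t + - b t) \<in> W"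
      using csubspace_scaleR[OF V bt, of "- 1"] ab(5)[OF t(1)] by (intro in_W) (auto simp: neg)
    ultimately have "dist ((1 / (1 + \<delta>)) *\<^sub>R (f - a t + b t)) ((1 / (1 + \<delta>)) *\<^sub>R (f - a t + - b t))
        \<le> diameter W"
      using diameter_bounded_bound[OF bounded] by blast
    also have "dist ((1 / (1 + \<delta>)) *\<^sub>R (f - a t + b t)) ((1 / (1 + \<delta>)) *\<^sub>R (f - a t + - b t))
        = 2 / (1 + \<delta>) * norm (b t)"
    proof -
      have "(1 / (1 + \<delta>)) *\<^sub>R (f - a t + b t) - (1 / (1 + \<delta>)) *\<^sub>R (f - a t + - b t)
          = (2 / (1 + \<delta>)) *\<^sub>R b t"
        by (simp add: algebra_simps flip: scaleR_add_left)
      then show ?thesis using \<delta>(1) by (simp add: dist_norm)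
    qed
    finally have "2 / (1 + \<delta>) * norm (b t) \<le> diameter W" .
    moreover have "2 / (1 + \<delta>) * 1 \<le> 2 / (1 + \<delta>) * norm (b t)"
      using ab(3)[OF t(1)] \<delta>(1) by (intro mult_left_mono) auto
    ultimately show ?thesis by simp
  qed
  \<comment> \<open>Letting \<open>\<delta>\<close> tend to 0 removes the loss from the
    normalisation; \<open>\<delta> < \<epsilon> / 2 / K\<close> is what \<open>lower\<close> asks
    for.\<close>
  have "((\<lambda>\<delta>. 2 / (1 + \<delta>)) \<longlongrightarrow> 2 / (1 + 0)) (at_right (0::real))"
    by (intro tendsto_intros) auto
  moreover have "\<forall>\<^sub>F \<delta> in at_right (0::real). 2 / (1 + \<delta>) \<le> diameter W"
    using eventually_at_right_real[of 0 "\<epsilon> / 2 / K"] F(3) K(1)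
    by (auto elim!: eventually_mono intro!: lower simp: pos_less_divide_eq)
  ultimately have "2 / (1 + 0) \<le> diameter W"
    by (rule tendsto_upperbound) simp
  moreover have "diameter W \<le> 2"
  proof (rule diameter_le)
    fix x y assume "x \<in> W" "y \<in> W"
    then show "norm (x - y) \<le> 2" using norm_triangle_ineq4[of x y] U(2) by auto
  qed simp
  ultimately show "diameter W = 2" by simp
qed

section \<open>Multiplication by functions of the disc algebra\<close>

lemma bounded_bilinear_scaleC:
  "bounded_bilinear (scaleC :: complex \<Rightarrow> 'a \<Rightarrow> 'a::complex_normed_vector)"
proof
  fix c d :: complex and r :: real and x y :: 'a
  show "(c + d) *\<^sub>C x = c *\<^sub>C x + d *\<^sub>C x" by (rule scaleC_add_left)
  show "c *\<^sub>C (x + y) = c *\<^sub>C x + c *\<^sub>C y" by (rule scaleC_add_right)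
  show "(r *\<^sub>R c) *\<^sub>C x = r *\<^sub>R (c *\<^sub>C x)"
    by (simp add: scaleR_conv_of_real scaleC_scaleC flip: scaleC_of_real)
  show "c *\<^sub>C (r *\<^sub>R x) = r *\<^sub>R (c *\<^sub>C x)"
    by (simp add: scaleC_scaleC mult.commute flip: scaleC_of_real)
  show "\<exists>K. \<forall>c (x::'a). norm (c *\<^sub>C x) \<le> norm c * norm x * K"
    by (rule exI[of _ 1]) (simp add: norm_scaleC)
qed

lemma scaleC_one: "1 *\<^sub>C x = (x :: 'a::complex_normed_vector)"
  using scaleC_of_real[of 1 x] by simp

lemma apply_bcontfun_sum: "apply_bcontfun (\<Sum>t\<in>T. f t) x = (\<Sum>t\<in>T. apply_bcontfun (f t) x)"
  for f :: "'t \<Rightarrow> 'a::topological_space \<Rightarrow>\<^sub>C 'b::real_normed_vector"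
  by (induction T rule: infinite_finite_induct) auto

lemma uniformly_continuous_on_scaleC:
  fixes m :: "'a::metric_space \<Rightarrow> complex" and f :: "'a \<Rightarrow> 'b::complex_normed_vector"
  assumes m: "uniformly_continuous_on S m" "\<And>x. x \<in> S \<Longrightarrow> cmod (m x) \<le> A"
    and f: "uniformly_continuous_on S f" "\<And>x. x \<in> S \<Longrightarrow> norm (f x) \<le> B"
  shows "uniformly_continuous_on S (\<lambda>x. m x *\<^sub>C f x)"
  unfolding uniformly_continuous_on_def
proof (intro allI impI)
  fix e :: real assume e: "0 < e"
  \<comment> \<open>One positive constant dominating both bounds, so that each half of the product
    difference costs less than \<open>e / 2\<close>.\<close>
  define C where "C = 1 + \<bar>A\<bar> + \<bar>B\<bar>"
  have C: "0 < C" "A \<le> C" "B \<le> C" by (auto simp: C_def)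
  obtain d where d: "0 < d" "\<And>x y. x \<in> S \<Longrightarrow> y \<in> S \<Longrightarrow> dist y x < d \<Longrightarrow> dist (m y) (m x) < e / (2 * C)"
    using m(1) e C(1) unfolding uniformly_continuous_on_def
    by (metis divide_pos_pos mult_pos_pos zero_less_numeral)
  obtain d' where d': "0 < d'" "\<And>x y. x \<in> S \<Longrightarrow> y \<in> S \<Longrightarrow> dist y x < d' \<Longrightarrow> dist (f y) (f x) < e / (2 * C)"
    using f(1) e C(1) unfolding uniformly_continuous_on_def
    by (metis divide_pos_pos mult_pos_pos zero_less_numeral)
  have "dist (m y *\<^sub>C f y) (m x *\<^sub>C f x) < e"
    if xy: "x \<in> S" "y \<in> S" "dist y x < min d d'" for x y
  proof -
    have "m y *\<^sub>C f y - m x *\<^sub>C f x = m y *\<^sub>C (f y - f x) + (m y - m x) *\<^sub>C f x"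
      by (simp add: bounded_bilinear.diff_left[OF bounded_bilinear_scaleC]
          bounded_bilinear.diff_right[OF bounded_bilinear_scaleC])
    then have "dist (m y *\<^sub>C f y) (m x *\<^sub>C f x) \<le>
        cmod (m y) * dist (f y) (f x) + dist (m y) (m x) * norm (f x)"
      unfolding dist_norm using norm_triangle_ineq by (metis norm_scaleC)
    also have "\<dots> \<le> C * dist (f y) (f x) + dist (m y) (m x) * C"
      using m(2)[OF xy(2)] f(2)[OF xy(1)] C
      by (intro add_mono mult_right_mono mult_left_mono) auto
    also have "\<dots> < C * (e / (2 * C)) + e / (2 * C) * C"
      using d(2)[OF xy(1,2)] d'(2)[OF xy(1,2)] xy(3) C(1)
      by (intro add_strict_mono mult_strict_left_mono mult_strict_right_mono) auto
    also have "\<dots> = e" using C(1) by (simp add: field_simps)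
    finally show ?thesis .
  qed
  with d(1) d'(1) show
    "\<exists>d>0. \<forall>x\<in>S. \<forall>y\<in>S. dist y x < d \<longrightarrow> dist (m y *\<^sub>C f y) (m x *\<^sub>C f x) < e"
    by (intro exI[of _ "min d d'"]) auto
qed

text \<open>Intended for bounded continuous \<open>m\<close>, for which the pointwise product is in
  the domain of \<open>Bcontfun\<close>.\<close>

definition mult_bcontfun ::
    "('a::topological_space \<Rightarrow> complex) \<Rightarrow> ('a \<Rightarrow>\<^sub>C 'b::complex_normed_vector) \<Rightarrow> ('a \<Rightarrow>\<^sub>C 'b)"
  where "mult_bcontfun m f = Bcontfun (\<lambda>x. m x *\<^sub>C apply_bcontfun f x)"

lemma apply_mult_bcontfun:
  assumes "continuous_on UNIV m" "bounded (range m)"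
  shows "apply_bcontfun (mult_bcontfun m f) x = m x *\<^sub>C apply_bcontfun f x"
proof -
  obtain B where B: "cmod (m x) \<le> B" for x
    using assms(2) by (auto simp: bounded_iff)
  have "(\<lambda>x. m x *\<^sub>C apply_bcontfun f x) \<in> bcontfun"
  proof (rule bcontfun_normI)
    show "continuous_on UNIV (\<lambda>x. m x *\<^sub>C apply_bcontfun f x)"
      by (intro bounded_bilinear.continuous_on[OF bounded_bilinear_scaleC] assms(1)
          continuous_on_apply_bcontfun)
    show "norm (m x *\<^sub>C apply_bcontfun f x) \<le> B * norm f" for x
      unfolding norm_scaleC using B order_trans[OF norm_ge_zero B]
      by (intro mult_mono norm_bounded) auto
  qed
  then show ?thesis by (simp add: mult_bcontfun_def Bcontfun_inverse)
qed

text \<open>A step of length \<open>e\<close> radially outwards raises the norm by \<open>e\<close>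
  and stays in the ball, so the norm was below 1. The centre has no radial direction and is treated
  apart.\<close>

lemma interior_unit_cball:
  fixes x :: "'a::real_normed_vector"
  assumes "x \<in> interior (cball 0 1)"
  shows "x \<in> ball 0 1"
proof (cases "x = 0")
  case False
  obtain e where e: "0 < e" "cball x e \<subseteq> cball 0 1"
    using assms by (auto simp: mem_interior_cball)
  have "x + e *\<^sub>R sgn x \<in> cball x e"
    using False e(1) by (simp add: dist_norm norm_sgn)
  with e(2) have "norm (x + e *\<^sub>R sgn x) \<le> 1" by auto
  also have "x + e *\<^sub>R sgn x = (norm x + e) *\<^sub>R sgn x"
  proof -
    have "norm x *\<^sub>R sgn x = x" using False by (simp add: sgn_div_norm)
    then show ?thesis by (simp add: scaleR_add_left)
  qed
  finally show ?thesis using False e(1) by (simp add: norm_sgn)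
qed simp

section \<open>The disc algebra pulled back along a contractive functional\<close>

locale contractive_functional =
  fixes \<psi> :: "'x::complex_banach \<Rightarrow> complex"
  assumes add: "\<psi> (x + y) = \<psi> x + \<psi> y"
    and scaleC: "\<psi> (c *\<^sub>C x) = c * \<psi> x"
    and norm_le: "cmod (\<psi> x) \<le> norm x"
begin

lemma bounded_linear: "bounded_linear \<psi>"
proof (rule bounded_linear_intro)
  show "\<psi> (r *\<^sub>R x) = r *\<^sub>R \<psi> x" for r x
    by (simp add: scaleC scaleR_conv_of_real flip: scaleC_of_real)
  show "norm (\<psi> x) \<le> norm x * 1" for x using norm_le by simp
qed (rule add)

lemma in_disc: "\<psi> (Rep_unit_ball x) \<in> cball 0 1"
  using norm_le[of "Rep_unit_ball x"] Rep_unit_ball[of x] by simp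

definition lift :: "(complex \<Rightarrow> complex) \<Rightarrow> 'x unit_ball \<Rightarrow> complex"
  where "lift q x = q (\<psi> (Rep_unit_ball x))"

text \<open>Compactness of the closed disc makes \<open>q\<close> uniformly continuous, and
  \<open>\<psi>\<close> is 1-Lipschitz.\<close>

lemma uniformly_continuous_lift:
  assumes "continuous_on (cball 0 1) q"
  shows "uniformly_continuous_on UNIV (lift q)"
proof -
  have q: "uniformly_continuous_on (cball 0 1) q"
    using assms by (rule compact_uniformly_continuous) simp
  have "dist (\<psi> (Rep_unit_ball x)) (\<psi> (Rep_unit_ball y)) \<le> dist x y" for x y
    using norm_le[of "Rep_unit_ball x - Rep_unit_ball y"]
    by (simp add: dist_norm dist_unit_ball_def linear_diff[OF bounded_linear.linear[OF bounded_linear]])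
  with q show ?thesis
    unfolding uniformly_continuous_on_def lift_def
    using in_disc by (meson UNIV_I order_le_less_trans)
qed

lemma continuous_lift: "continuous_on (cball 0 1) q \<Longrightarrow> continuous_on UNIV (lift q)"
  by (rule uniformly_continuous_imp_continuous[OF uniformly_continuous_lift])

lemma bounded_lift:
  assumes "continuous_on (cball 0 1) q"
  shows "bounded (range (lift q))"
proof (rule bounded_subset)
  show "bounded (q ` cball 0 1)"
    using assms by (intro compact_imp_bounded compact_continuous_image) auto
  show "range (lift q) \<subseteq> q ` cball 0 1"
    using in_disc by (auto simp: lift_def)
qed

text \<open>Chain rule and product rule; the derivative stays complex-linear because
  \<open>\<psi>\<close> and \<open>D\<close> are and \<open>q'\<close> acts by
  multiplication.\<close>

lemma mult_in_A_b:
  assumes q: "continuous_on (cball 0 1) q" "\<And>z. z \<in> ball 0 1 \<Longrightarrow> q field_differentiable (at z)"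
    and f: "f \<in> (A_b :: ('x unit_ball \<Rightarrow>\<^sub>C 'y::complex_banach) set)"
  shows "mult_bcontfun (lift q) f \<in> A_b"
proof -
  have "\<exists>D. ((\<lambda>x. apply_bcontfun (mult_bcontfun (lift q) f) (Abs_unit_ball x)) has_derivative D) (at x)
      \<and> (\<forall>c h. D (c *\<^sub>C h) = c *\<^sub>C D h)" if "x \<in> interior (cball 0 1)" for x
  proof -
    have x: "x \<in> ball 0 1" using that by (rule interior_unit_cball)
    obtain D where D: "((\<lambda>x. apply_bcontfun f (Abs_unit_ball x)) has_derivative D) (at x)"
      "\<forall>c h. D (c *\<^sub>C h) = c *\<^sub>C D h"
    proof -
      have "cholomorphic_on (\<lambda>x. apply_bcontfun f (Abs_unit_ball x)) (interior (cball 0 1))"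
        using f by (simp add: A_b_def)
      from this[unfolded cholomorphic_on_def, rule_format, OF \<open>x \<in> interior _\<close>]
      show ?thesis by (elim exE conjE) (rule that)
    qed
    have "\<psi> x \<in> ball 0 1" using norm_le[of x] x by simp
    then obtain q' where "(q has_field_derivative q') (at (\<psi> x))"
      using q(2) unfolding field_differentiable_def by blast
    then have "(q has_derivative (*) q') (at (\<psi> x))"
      by (simp add: has_field_derivative_def)
    then have q': "((\<lambda>x. q (\<psi> x)) has_derivative (\<lambda>h. q' * \<psi> h)) (at x)"
      by (rule has_derivative_compose[OF bounded_linear_imp_has_derivative[OF bounded_linear]])
    let ?E = "\<lambda>h. q (\<psi> x) *\<^sub>C D h + (q' * \<psi> h) *\<^sub>C apply_bcontfun f (Abs_unit_ball x)"
    have "((\<lambda>x. q (\<psi> x) *\<^sub>C apply_bcontfun f (Abs_unit_ball x)) has_derivative ?E) (at x)"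
      by (rule bounded_bilinear.FDERIV[OF bounded_bilinear_scaleC q' D(1)])
    \<comment> \<open>On the open ball \<open>Abs_unit_ball\<close> is inverted by
      \<open>Rep_unit_ball\<close>, so the two functions agree near \<open>x\<close>.\<close>
    then have "((\<lambda>x. apply_bcontfun (mult_bcontfun (lift q) f) (Abs_unit_ball x))
        has_derivative ?E) (at x)"
      by (rule has_derivative_transform_within_open[OF _ open_ball x])
        (simp add: apply_mult_bcontfun[OF continuous_lift[OF q(1)] bounded_lift[OF q(1)]] lift_def
          Abs_unit_ball_inverse)
    moreover have "?E (c *\<^sub>C h) = c *\<^sub>C ?E h" for c h
      using D(2) by (simp add: scaleC scaleC_add_right scaleC_scaleC mult_ac)
    ultimately show ?thesis by (intro exI[of _ ?E] conjI allI)
  qed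
  then show ?thesis by (simp add: A_b_def C_b_def cholomorphic_on_def)
qed

lemma mult_in_A_u:
  assumes q: "continuous_on (cball 0 1) q" "\<And>z. z \<in> ball 0 1 \<Longrightarrow> q field_differentiable (at z)"
    and f: "f \<in> (A_u :: ('x unit_ball \<Rightarrow>\<^sub>C 'y::complex_banach) set)"
  shows "mult_bcontfun (lift q) f \<in> A_u"
proof -
  obtain B where B: "\<And>x. cmod (lift q x) \<le> B"
    using bounded_lift[OF q(1)] by (auto simp: bounded_iff)
  have "uniformly_continuous_on UNIV (\<lambda>x. lift q x *\<^sub>C apply_bcontfun f x)"
    using f B
    by (intro uniformly_continuous_on_scaleC[OF uniformly_continuous_lift[OF q(1)], where B = "norm f"])
      (auto simp: A_u_def norm_bounded)
  moreover have "apply_bcontfun (mult_bcontfun (lift q) f) = (\<lambda>x. lift q x *\<^sub>C apply_bcontfun f x)"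
    by (simp add: fun_eq_iff apply_mult_bcontfun continuous_lift bounded_lift q(1))
  ultimately show ?thesis
    using mult_in_A_b[OF q, of f] f by (simp add: A_u_def)
qed

text \<open>Treats the three spaces together: multiplication by the peak at \<open>t\<close> turns
  \<open>f\<close> and the constant \<open>y\<close> into the families required by the
  criterion.\<close>

lemma diameter_two_property_module:
  fixes V :: "('x unit_ball \<Rightarrow>\<^sub>C 'y::complex_banach) set"
  assumes V: "csubspace V"
    and mult: "\<And>q f. \<lbrakk>continuous_on (cball 0 1) q; \<And>z. z \<in> ball 0 1 \<Longrightarrow> q field_differentiable (at z);
      f \<in> V\<rbrakk> \<Longrightarrow> mult_bcontfun (lift q) f \<in> V"
    and y: "const_bcontfun y \<in> V" "norm y = 1"
    and z: "norm z = 1" "\<psi> z = 1"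
  shows "diameter_two_property V"
proof (rule diameter_two_propertyI[where M = 2, OF V])
  fix f :: "'x unit_ball \<Rightarrow>\<^sub>C 'y" and \<delta> :: real and N :: nat
  assume f: "f \<in> V" "norm f \<le> 1" and pos: "0 < \<delta>" "0 < N"
  \<comment> \<open>The roots of unity serve as \<open>N\<close> distinct points of the unit
    circle.\<close>
  define T where "T = {t::complex. t ^ N = 1}"
  have T: "finite T" "card T = N"
    using pos by (simp_all add: T_def finite_roots_unity card_roots_unity_eq)
  have norm_T: "cmod t = 1" if "t \<in> T" for t
    using that power_eq_1_iff[of t N] pos by (simp add: T_def)
  obtain r where r: "0 < r" "\<And>s t. s \<in> T \<Longrightarrow> t \<in> T \<Longrightarrow> s \<noteq> t \<Longrightarrow> 2 * r \<le> dist s t"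
  proof -
    \<comment> \<open>Inserting 1 keeps the set nonempty when \<open>N = 1\<close>. Half its minimum
      is \<open>2 * r\<close>-separation at work: discs of radius \<open>r\<close> about the points
      are disjoint.\<close>
    define R where "R = insert 1 ((\<lambda>(s, t). dist s t) ` (T \<times> T - Id))"
    have R: "finite R" "R \<noteq> {}" "\<And>d. d \<in> R \<Longrightarrow> 0 < d"
      using T(1) by (auto simp: R_def)
    show ?thesis
    proof (rule that[of "Min R / 2"])
      show "0 < Min R / 2" using R by simp
      show "2 * (Min R / 2) \<le> dist s t" if "s \<in> T" "t \<in> T" "s \<noteq> t" for s t
        using that R(1) by (auto simp: R_def intro!: Min_le)
    qed
  qed
  have "\<forall>t\<in>T. \<exists>q. continuous_on (cball 0 1) q \<and>
      (\<forall>z\<in>ball 0 1. q field_differentiable (at z)) \<and> q t = 1 \<and>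
      (\<forall>z\<in>cball 0 1. cmod (q z) \<le> 1 \<and> cmod (1 - q z) + cmod (q z) \<le> 1 + \<delta> \<and>
        (r \<le> dist z t \<longrightarrow> cmod (q z) \<le> 1 / N))"
  proof
    fix t assume "t \<in> T"
    then show "\<exists>q. continuous_on (cball 0 1) q \<and>
      (\<forall>z\<in>ball 0 1. q field_differentiable (at z)) \<and> q t = 1 \<and>
      (\<forall>z\<in>cball 0 1. cmod (q z) \<le> 1 \<and> cmod (1 - q z) + cmod (q z) \<le> 1 + \<delta> \<and>
        (r \<le> dist z t \<longrightarrow> cmod (q z) \<le> 1 / N))"
      using peak_function[OF norm_T pos(1) r(1), of t "1 / N"] pos(2)
      by (metis (no_types, lifting) divide_pos_pos of_nat_0_less_iff zero_less_one)
  qed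
  from bchoice[OF this] obtain q where
    q: "\<And>t. t \<in> T \<Longrightarrow> continuous_on (cball 0 1) (q t)"
      "\<And>t z. t \<in> T \<Longrightarrow> z \<in> ball 0 1 \<Longrightarrow> q t field_differentiable (at z)"
      "\<And>t. t \<in> T \<Longrightarrow> q t t = 1"
    and q_bounds: "\<And>t z. t \<in> T \<Longrightarrow> z \<in> cball 0 1 \<Longrightarrow> cmod (q t z) \<le> 1"
      "\<And>t z. t \<in> T \<Longrightarrow> z \<in> cball 0 1 \<Longrightarrow> cmod (1 - q t z) + cmod (q t z) \<le> 1 + \<delta>"
      "\<And>t z. t \<in> T \<Longrightarrow> z \<in> cball 0 1 \<Longrightarrow> r \<le> dist z t \<Longrightarrow> cmod (q t z) \<le> 1 / N"
    by blast
  \<comment> \<open>At most one point lies within \<open>r\<close> of \<open>z\<close> and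
    contributes at most 1; the \<open>N\<close> terms \<open>1 / N\<close> cover the rest.\<close>
  have q_sum: "(\<Sum>t\<in>T. cmod (q t z)) \<le> 2" if z: "z \<in> cball 0 1" for z
  proof -
    have "s = t" if "s \<in> T" "t \<in> T" "dist z s < r" "dist z t < r" for s t
      using r(2)[of s t] that dist_triangle2[of s t z] by (force simp: dist_commute)
    then have "card {t \<in> T. dist z t < r} \<le> Suc 0"
      using T(1) by (subst card_le_Suc0_iff_eq) auto
    have "(\<Sum>t\<in>T. cmod (q t z)) \<le> (\<Sum>t\<in>T. (if dist z t < r then 1 else 0) + 1 / N)"
      using q_bounds(1,3)[OF _ z] by (intro sum_mono) (auto simp: not_less add_increasing2)
    also have "\<dots> = card {t \<in> T. dist z t < r} + card T * (1 / N)"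
      using T(1) by (simp add: sum.distrib flip: sum.inter_filter)
    also have "\<dots> \<le> 2" using T(2) pos \<open>card _ \<le> Suc 0\<close> by simp
    finally show ?thesis .
  qed
  define m :: "complex \<Rightarrow> ('x unit_ball \<Rightarrow>\<^sub>C 'y) \<Rightarrow> ('x unit_ball \<Rightarrow>\<^sub>C 'y)"
    where "m t = mult_bcontfun (lift (q t))" for t
  have m_V: "m t (g :: 'x unit_ball \<Rightarrow>\<^sub>C 'y) \<in> V" if "t \<in> T" "g \<in> V" for t g
    unfolding m_def using q(1,2) that by (intro mult) auto
  have apply_m: "apply_bcontfun (m t g) x = lift (q t) x *\<^sub>C apply_bcontfun g x"
    if "t \<in> T" for t x and g :: "'x unit_ball \<Rightarrow>\<^sub>C 'y"
    unfolding m_def using q(1)[OF that] by (intro apply_mult_bcontfun continuous_lift bounded_lift)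
  define b :: "'x unit_ball \<Rightarrow>\<^sub>C 'y" where "b = const_bcontfun y"
  have b: "apply_bcontfun b x = y" for x by (simp add: b_def const_bcontfun.rep_eq)
  have norm_b: "norm b \<le> 1" by (rule norm_bound) (simp add: b y)
  have combination: "norm (\<Sum>t\<in>T. c t *\<^sub>C m t g) \<le> 2"
    if c: "\<forall>t\<in>T. cmod (c t) \<le> 1" and g: "norm g \<le> 1" for c and g :: "'x unit_ball \<Rightarrow>\<^sub>C 'y"
  proof (rule norm_bound)
    fix x
    have "norm (apply_bcontfun (\<Sum>t\<in>T. c t *\<^sub>C m t g) x) \<le>
        (\<Sum>t\<in>T. norm (c t *\<^sub>C lift (q t) x *\<^sub>C apply_bcontfun g x))"
      by (simp add: apply_bcontfun_sum apply_bcontfun_scaleC apply_m norm_sum)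
    also have "\<dots> \<le> (\<Sum>t\<in>T. 1 * (cmod (q t (\<psi> (Rep_unit_ball x))) * 1))"
      using c order_trans[OF norm_bounded g, of x]
      unfolding norm_scaleC lift_def by (intro sum_mono mult_mono) auto
    also have "\<dots> \<le> 2" using q_sum[OF in_disc] by simp
    finally show "norm (apply_bcontfun (\<Sum>t\<in>T. c t *\<^sub>C m t g) x) \<le> 2" .
  qed
  have perturbed: "norm (f - m t f + m t g) \<le> 1 + \<delta>"
    if "t \<in> T" "norm g \<le> 1" for t and g :: "'x unit_ball \<Rightarrow>\<^sub>C 'y"
  proof (rule norm_bound)
    fix x
    \<comment> \<open>Pointwise the values of \<open>f\<close> and \<open>g\<close> carry weights
      \<open>1 - q\<close> and \<open>q\<close>, whose moduli sum to at most
      \<open>1 + \<delta>\<close>.\<close>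
    have "apply_bcontfun (f - m t f + m t g) x =
        (1 - lift (q t) x) *\<^sub>C apply_bcontfun f x + lift (q t) x *\<^sub>C apply_bcontfun g x"
      by (simp add: apply_m that(1) scaleC_one bounded_bilinear.diff_left[OF bounded_bilinear_scaleC])
    then have "norm (apply_bcontfun (f - m t f + m t g) x) \<le>
        cmod (1 - lift (q t) x) * norm (apply_bcontfun f x) +
        cmod (lift (q t) x) * norm (apply_bcontfun g x)"
      using norm_triangle_ineq by (metis norm_scaleC)
    also have "\<dots> \<le> cmod (1 - lift (q t) x) * 1 + cmod (lift (q t) x) * 1"
      using order_trans[OF norm_bounded f(2), of x] order_trans[OF norm_bounded that(2), of x]
      by (intro add_mono mult_left_mono) auto
    also have "\<dots> \<le> 1 + \<delta>" using q_bounds(2)[OF that(1) in_disc] by (simp add: lift_def)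
    finally show "norm (apply_bcontfun (f - m t f + m t g) x) \<le> 1 + \<delta>" .
  qed
  have "norm (f - m t f - m t b) \<le> 1 + \<delta>" if "t \<in> T" for t
  proof -
    have "m t (- b) = - m t b"
      by (rule bcontfun_eqI)
        (simp add: apply_m that bounded_bilinear.minus_right[OF bounded_bilinear_scaleC])
    then show ?thesis using perturbed[OF that, of "- b"] norm_b by simp
  qed
  moreover have "1 \<le> norm (m t b)" if "t \<in> T" for t
  proof -
    \<comment> \<open>The norm is attained at \<open>t *\<^sub>C z\<close>, which
      \<open>\<psi>\<close> sends to the peak point \<open>t\<close>.\<close>
    have "Rep_unit_ball (Abs_unit_ball (t *\<^sub>C z)) = t *\<^sub>C z"
      using norm_T[OF that] z by (intro Abs_unit_ball_inverse) (simp add: norm_scaleC)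
    then have "apply_bcontfun (m t b) (Abs_unit_ball (t *\<^sub>C z)) = y"
      using q(3)[OF that] by (simp add: apply_m that b lift_def scaleC z scaleC_one)
    then show ?thesis using norm_bounded[of "m t b" "Abs_unit_ball (t *\<^sub>C z)"] y by simp
  qed
  ultimately have "\<forall>t\<in>T. m t f \<in> V \<and> m t b \<in> V \<and> 1 \<le> norm (m t b) \<and>
      norm (f - m t f + m t b) \<le> 1 + \<delta> \<and> norm (f - m t f - m t b) \<le> 1 + \<delta>"
    using m_V f(1) y(1) perturbed norm_b by (auto simp: b_def)
  moreover have "\<forall>c. (\<forall>t\<in>T. cmod (c t) \<le> 1) \<longrightarrow>
      norm (\<Sum>t\<in>T. c t *\<^sub>C m t f) \<le> 2 \<and> norm (\<Sum>t\<in>T. c t *\<^sub>C m t b) \<le> 2"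
    using combination f(2) norm_b by blast
  ultimately show "\<exists>(T :: complex set) a b. finite T \<and> card T = N \<and>
        (\<forall>t\<in>T. a t \<in> V \<and> b t \<in> V \<and> 1 \<le> norm (b t) \<and>
          norm (f - a t + b t) \<le> 1 + \<delta> \<and> norm (f - a t - b t) \<le> 1 + \<delta>) \<and>
        (\<forall>c. (\<forall>t\<in>T. cmod (c t) \<le> 1) \<longrightarrow>
          norm (\<Sum>t\<in>T. c t *\<^sub>C a t) \<le> 2 \<and> norm (\<Sum>t\<in>T. c t *\<^sub>C b t) \<le> 2)"
    using T by (intro exI[of _ T] exI[of _ "\<lambda>t. m t f"] exI[of _ "\<lambda>t. m t b"] conjI)
qed

end

section \<open>Application to the three function spaces\<close>

lemma const_bcontfun_in_A_u:
  "const_bcontfun y \<in> (A_u :: ('x::complex_banach unit_ball \<Rightarrow>\<^sub>C 'y::complex_banach) set)"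
proof -
  have "c *\<^sub>C (0::'y) = 0" for c
    using norm_scaleC[of c "0::'y"] by simp
  then show ?thesis
    by (auto simp: A_u_def A_b_def C_b_def cholomorphic_on_def const_bcontfun.rep_eq
        intro!: exI[of _ "\<lambda>_. 0"] uniformly_continuous_on_const)
qed

theorem corollary4p10:
  assumes "\<exists>x::'x::complex_banach. x \<noteq> 0"
    and "\<exists>y::'y::complex_banach. y \<noteq> 0"
  shows "diameter_two_property (C_b :: ('x unit_ball \<Rightarrow>\<^sub>C 'y) set) \<and>
    diameter_two_property (A_b :: ('x unit_ball \<Rightarrow>\<^sub>C 'y) set) \<and>
    diameter_two_property (A_u :: ('x unit_ball \<Rightarrow>\<^sub>C 'y) set)"
proof -
  obtain z :: 'x where z: "norm z = 1"
    using assms(1) by (metis norm_sgn)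
  obtain y :: 'y where y: "norm y = 1"
    using assms(2) by (metis norm_sgn)
  \<comment> \<open>Contractivity maps the ball into the disc; the value 1 at the unit vector
    \<open>z\<close> makes every point of the unit circle an image.\<close>
  obtain \<psi> :: "'x \<Rightarrow> complex" where \<psi>: "\<And>x y. \<psi> (x + y) = \<psi> x + \<psi> y" "\<And>c x. \<psi> (c *\<^sub>C x) = c * \<psi> x"
    "\<And>x. cmod (\<psi> x) \<le> norm x" "\<psi> z = of_real (norm z)"
    using norming_functional[of z] by blast
  interpret contractive_functional \<psi>
    by standard (fact \<psi>)+
  have const: "const_bcontfun y \<in> (A_u :: ('x unit_ball \<Rightarrow>\<^sub>C 'y) set)"
    "const_bcontfun y \<in> (A_b :: ('x unit_ball \<Rightarrow>\<^sub>C 'y) set)"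
    using const_bcontfun_in_A_u[of y, where 'x = 'x] by (simp_all add: A_u_def)
  have "\<psi> z = 1" using \<psi>(4) z by simp
  with y z show ?thesis
    by (intro conjI diameter_two_property_module[where y = y and z = z] csubspace_C_b csubspace_A_b
        csubspace_A_u mult_in_A_b mult_in_A_u const) (simp_all add: C_b_def)
qed

end
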